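(* Let $n\ge p\ge2$. Then the Rees factor semigroup $Q_p(n)=K(n,p)/K(n,p-1)$ is an inverse semigroup.
   Context: $[n]=\{1,\ldots,n\}$. $\mathcal{ORCT}_n$ is the semigroup, under composition, of all maps $\alpha:[n]\to[n]$ that satisfy $|x\alpha-y\alpha|\le|x-y|$ for all $x,y\in[n]$ and are either order preserving or order reversing. $\mathrm{Reg}(\mathcal{ORCT}_n)$ is the set of regular elements of $\mathcal{ORCT}_n$ (those $a$ with $a=aba$ for some $b\in\mathcal{ORCT}_n$); it is a subsemigroup. For $1\le q\le n$, $K(n,q)=\{\alpha\in\mathrm{Reg}(\mathcal{ORCT}_n):|\mathrm{Im}\,\alpha|\le q\}$, a two-sided ideal of $\mathrm{Reg}(\mathcal{ORCT}_n)$. $Q_p(n)=K(n,p)/K(n,p-1)$ is the Rees quotient: its elements are the elements of $\mathrm{Reg}(\mathcal{ORCT}_n)$ with image of size exactly $p$ together with a zero; the product of two nonzero elements is their product in $\mathrm{Reg}(\mathcal{ORCT}_n)$ if that has image of size $p$, and zero otherwise. *)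

theory Defs
  imports Main "HOL-Library.FuncSet"
begin

locale semigroup_on =
  fixes S :: "'a set" and mult :: "'a \<Rightarrow> 'a \<Rightarrow> 'a"
  assumes closed: "a \<in> S \<Longrightarrow> b \<in> S \<Longrightarrow> mult a b \<in> S"
    and assoc: "a \<in> S \<Longrightarrow> b \<in> S \<Longrightarrow> c \<in> S \<Longrightarrow> mult (mult a b) c = mult a (mult b c)"

locale inverse_semigroup_on = semigroup_on +
  assumes unique_inverse:
    "a \<in> S \<Longrightarrow> \<exists>!b. b \<in> S \<and> mult (mult a b) a = a \<and> mult (mult b a) b = b"

definition regular_elements :: "'a set \<Rightarrow> ('a \<Rightarrow> 'a \<Rightarrow> 'a) \<Rightarrow> 'a set" where
  "regular_elements S mult = {a \<in> S. \<exists>b \<in> S. mult (mult a b) a = a}"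

text \<open>The Rees quotient of a semigroup \<open>S\<close> by a nonempty ideal \<open>I\<close>: the class \<open>I\<close> is the
  zero \<open>None\<close>, and every other class is a singleton \<open>{a}\<close>, represented by \<open>Some a\<close>.\<close>

definition rees_carrier :: "'a set \<Rightarrow> 'a set \<Rightarrow> 'a option set" where
  "rees_carrier S I = insert None (Some ` (S - I))"

definition rees_mult ::
    "'a set \<Rightarrow> ('a \<Rightarrow> 'a \<Rightarrow> 'a) \<Rightarrow> 'a option \<Rightarrow> 'a option \<Rightarrow> 'a option" where
  "rees_mult I mult u v =
     (case (u, v) of
        (Some a, Some b) \<Rightarrow> (if mult a b \<in> I then None else Some (mult a b))
      | _ \<Rightarrow> None)"

text \<open>Self-maps of \<open>{1..n}\<close> are extensional functions, so that equality of functions is equality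
  of maps.\<close>

definition ORCT :: "nat \<Rightarrow> (nat \<Rightarrow> nat) set" where
  "ORCT n = {\<alpha> \<in> {1..n} \<rightarrow>\<^sub>E {1..n}.
     (\<forall>x\<in>{1..n}. \<forall>y\<in>{1..n}. \<bar>int (\<alpha> x) - int (\<alpha> y)\<bar> \<le> \<bar>int x - int y\<bar>) \<and>
     (mono_on {1..n} \<alpha> \<or> antimono_on {1..n} \<alpha>)}"

text \<open>Maps act on the right: \<open>map_mult n \<alpha> \<beta>\<close> applies \<open>\<alpha>\<close> first.\<close>

definition map_mult :: "nat \<Rightarrow> (nat \<Rightarrow> nat) \<Rightarrow> (nat \<Rightarrow> nat) \<Rightarrow> (nat \<Rightarrow> nat)" where
  "map_mult n \<alpha> \<beta> = compose {1..n} \<beta> \<alpha>"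

definition RegORCT :: "nat \<Rightarrow> (nat \<Rightarrow> nat) set" where
  "RegORCT n = regular_elements (ORCT n) (map_mult n)"

definition K :: "nat \<Rightarrow> nat \<Rightarrow> (nat \<Rightarrow> nat) set" where
  "K n q = {\<alpha> \<in> RegORCT n. card (\<alpha> ` {1..n}) \<le> q}"

definition Q_carrier :: "nat \<Rightarrow> nat \<Rightarrow> (nat \<Rightarrow> nat) option set" where
  "Q_carrier n p = rees_carrier (K n p) (K n (p - 1))"

definition Q_mult ::
    "nat \<Rightarrow> nat \<Rightarrow> (nat \<Rightarrow> nat) option \<Rightarrow> (nat \<Rightarrow> nat) option \<Rightarrow> (nat \<Rightarrow> nat) option" where
  "Q_mult n p = rees_mult (K n (p - 1)) (map_mult n)"

end

theory Submission
  imports Defs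
begin

text \<open>If \<open>\<alpha>\<beta>\<alpha> = \<alpha>\<close>, then \<open>\<alpha>\<close> and \<open>\<beta>\<close>, both being contractions, are isometric between the image
  of \<open>\<alpha>\<close> and its image under \<open>\<beta>\<close>. Hence a regular \<open>\<alpha>\<close> carries an interval \<open>{d..d+k}\<close> onto its image
  \<open>{c..c+k}\<close> by a translation or a reflection and is constant on either side of \<open>{d..d+k}\<close>. In rank
  \<open>p = k + 1 \<ge> 2\<close> the product of the maps with data \<open>(d, c)\<close> and \<open>(d', c')\<close> keeps its rank iff \<open>c = d'\<close>,
  and then has data \<open>(d, c')\<close>. So \<open>Q_p(n)\<close> is a Brandt semigroup over the group of order two.\<close>

declare One_nat_def [simp del]

section \<open>Rees quotients\<close>

text \<open>Since \<open>I\<close> absorbs products on both sides, a bracketing that enters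
  \<open>I\<close> early stays there. So for nonzero factors both bracketings vanish exactly when
  the product of all three lies in \<open>I\<close>.\<close>

lemma semigroup_on_rees:
  assumes "semigroup_on S mult"
    and left: "\<And>a b. a \<in> S \<Longrightarrow> b \<in> I \<Longrightarrow> b \<in> S \<Longrightarrow> mult a b \<in> I"
    and right: "\<And>a b. a \<in> I \<Longrightarrow> a \<in> S \<Longrightarrow> b \<in> S \<Longrightarrow> mult a b \<in> I"
  shows "semigroup_on (rees_carrier S I) (rees_mult I mult)"
proof -
  interpret semigroup_on S mult by fact
  show ?thesis
  proof
    fix u v assume "u \<in> rees_carrier S I" "v \<in> rees_carrier S I"
    then show "rees_mult I mult u v \<in> rees_carrier S I"
      by (auto simp: rees_carrier_def rees_mult_def closed split: if_splits)
  next
    fix u v w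
    assume "u \<in> rees_carrier S I" "v \<in> rees_carrier S I" "w \<in> rees_carrier S I"
    then show "rees_mult I mult (rees_mult I mult u v) w = rees_mult I mult u (rees_mult I mult v w)"
      unfolding rees_carrier_def rees_mult_def
      by (auto simp: assoc split: option.splits) (metis assoc closed left right)+
  qed
qed

section \<open>Regular elements\<close>

definition clamp :: "nat \<Rightarrow> nat \<Rightarrow> nat \<Rightarrow> bool \<Rightarrow> nat \<Rightarrow> nat" where
  "clamp k d c r x = c + (if r then k - min k (x - d) else min k (x - d))"

text \<open>The truncated subtraction \<open>x - d\<close> makes \<open>clamp\<close> constant to the left of \<open>d\<close>.\<close>

definition clamp_map :: "nat \<Rightarrow> nat \<Rightarrow> nat \<Rightarrow> nat \<Rightarrow> bool \<Rightarrow> nat \<Rightarrow> nat" where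
  "clamp_map n k d c r = restrict (clamp k d c r) {1..n}"

definition clamp_bounds :: "nat \<Rightarrow> nat \<Rightarrow> nat \<Rightarrow> nat \<Rightarrow> bool" where
  "clamp_bounds n k d c \<longleftrightarrow> 1 \<le> d \<and> d + k \<le> n \<and> 1 \<le> c \<and> c + k \<le> n"

lemma clamp_in: "clamp_bounds n k d c \<Longrightarrow> clamp k d c r x \<in> {1..n}"
  by (auto simp: clamp_bounds_def clamp_def)

lemma clamp_left: "x \<le> d \<Longrightarrow> clamp k d c r x = (if r then c + k else c)"
  by (simp add: clamp_def)

lemma clamp_right: "d + k \<le> x \<Longrightarrow> clamp k d c r x = (if r then c else c + k)"
  by (simp add: clamp_def)

lemma clamp_middle:
  "d \<le> x \<Longrightarrow> x \<le> d + k \<Longrightarrow> clamp k d c r x = (if r then c + k - (x - d) else c + (x - d))"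
  by (auto simp: clamp_def)

lemma clamp_image:
  assumes "clamp_bounds n k d c"
  shows "clamp k d c r ` {1..n} = {c..c + k}"
proof
  show "clamp k d c r ` {1..n} \<subseteq> {c..c + k}"
    by (auto simp: clamp_def)
  show "{c..c + k} \<subseteq> clamp k d c r ` {1..n}"
  proof
    fix y assume y: "y \<in> {c..c + k}"
    \<comment> \<open>The witness is the preimage of \<open>y\<close> in \<open>{d..d + k}\<close>,
      measured from the top of the image if \<open>r\<close> reflects.\<close>
    show "y \<in> clamp k d c r ` {1..n}"
      using assms y
      by (intro image_eqI[where x = "if r then d + (c + k - y) else d + (y - c)"])
        (auto simp: clamp_def clamp_bounds_def)
  qed
qed

lemma card_clamp_map:
  "clamp_bounds n k d c \<Longrightarrow> card (clamp_map n k d c r ` {1..n}) = Suc k"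
  by (simp add: clamp_map_def clamp_image)

lemma clamp_map_in_ORCT:
  assumes "clamp_bounds n k d c"
  shows "clamp_map n k d c r \<in> ORCT n"
proof -
  have "\<bar>int (clamp k d c r x) - int (clamp k d c r y)\<bar> \<le> \<bar>int x - int y\<bar>" for x y
    by (auto simp: clamp_def min_def)
  moreover have "mono_on {1..n} (clamp_map n k d c r) \<or> antimono_on {1..n} (clamp_map n k d c r)"
    by (cases r) (auto simp: monotone_on_def clamp_map_def clamp_def)
  moreover have "clamp_map n k d c r \<in> {1..n} \<rightarrow>\<^sub>E {1..n}"
    using clamp_in[OF assms] by (auto simp: clamp_map_def)
  ultimately show ?thesis
    by (simp add: ORCT_def clamp_map_def)
qed

text \<open>The first factor has its values in \<open>{1..n}\<close>, where restricting the second
  factor changes nothing.\<close>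

lemma map_mult_clamp_map:
  assumes "clamp_bounds n k d c"
  shows "map_mult n (clamp_map n k d c r) (clamp_map n k' d' c' r') =
    restrict (clamp k' d' c' r' \<circ> clamp k d c r) {1..n}"
  using clamp_in[OF assms] by (auto simp: map_mult_def compose_def clamp_map_def)

text \<open>On the image \<open>{c..c + k}\<close> of the first factor the second is a pure
  translation or reflection, and orientations combine by exclusive or.\<close>

lemma map_mult_matching:
  assumes "clamp_bounds n k d c"
  shows "map_mult n (clamp_map n k d c r) (clamp_map n k c c' r') = clamp_map n k d c' (r \<noteq> r')"
  unfolding map_mult_clamp_map[OF assms] by (auto simp: clamp_map_def clamp_def)

text \<open>Exchanging \<open>d\<close> and \<open>c\<close> while keeping \<open>r\<close> gives an
  inverse: the orientations combine to \<open>(r \<noteq> r) \<noteq> r\<close>, which is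
  \<open>r\<close>.\<close>

lemma clamp_map_in_RegORCT:
  assumes "clamp_bounds n k d c"
  shows "clamp_map n k d c r \<in> RegORCT n"
proof -
  have *: "clamp_bounds n k c d" using assms by (auto simp: clamp_bounds_def)
  have "map_mult n (map_mult n (clamp_map n k d c r) (clamp_map n k c d r)) (clamp_map n k d c r)
      = clamp_map n k d c r"
    using assms by (simp add: map_mult_matching clamp_bounds_def)
  then show ?thesis
    using clamp_map_in_ORCT[OF assms] clamp_map_in_ORCT[OF *]
    unfolding RegORCT_def regular_elements_def by blast
qed

text \<open>The map \<open>\<beta>\<close> picks points \<open>x\<^sub>0\<close> and
  \<open>y\<^sub>0\<close> where \<alpha> takes its end values. Monotonicity makes \<alpha> constant
  outside the interval between them, and tight contraction bounds fix it inside.\<close>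

lemma RegORCT_is_clamp_map:
  assumes "\<alpha> \<in> RegORCT n" "1 \<le> n"
  obtains k d c r where "clamp_bounds n k d c" "\<alpha> = clamp_map n k d c r"
proof -
  obtain \<beta> where \<alpha>: "\<alpha> \<in> ORCT n" and \<beta>: "\<beta> \<in> ORCT n"
    and reg: "map_mult n (map_mult n \<alpha> \<beta>) \<alpha> = \<alpha>"
    using assms by (auto simp: RegORCT_def regular_elements_def)
  have \<alpha>_in: "\<alpha> x \<in> {1..n}" and \<beta>_in: "\<beta> x \<in> {1..n}" if "x \<in> {1..n}" for x
    using \<alpha> \<beta> that by (auto simp: ORCT_def)
  have contr: "\<bar>int (\<alpha> x) - int (\<alpha> y)\<bar> \<le> \<bar>int x - int y\<bar>"
    "\<bar>int (\<beta> x) - int (\<beta> y)\<bar> \<le> \<bar>int x - int y\<bar>" if "x \<in> {1..n}" "y \<in> {1..n}" for x y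
    using \<alpha> \<beta> that by (auto simp: ORCT_def)
  have \<alpha>\<beta>\<alpha>: "\<alpha> (\<beta> (\<alpha> x)) = \<alpha> x" if "x \<in> {1..n}" for x
    using fun_cong[OF reg, of x] that by (simp add: map_mult_def compose_def)
  have \<alpha>_ext: "\<alpha> x = undefined" if "x \<notin> {1..n}" for x
    using \<alpha> that by (auto simp: ORCT_def)
  define x\<^sub>0 where "x\<^sub>0 = \<beta> (\<alpha> 1)"
  define y\<^sub>0 where "y\<^sub>0 = \<beta> (\<alpha> n)"
  have ends: "1 \<in> {1..n}" "n \<in> {1..n}" using assms(2) by auto
  have x\<^sub>0: "x\<^sub>0 \<in> {1..n}" "\<alpha> x\<^sub>0 = \<alpha> 1" and y\<^sub>0: "y\<^sub>0 \<in> {1..n}" "\<alpha> y\<^sub>0 = \<alpha> n"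
    using \<alpha>_in \<beta>_in \<alpha>\<beta>\<alpha> ends by (auto simp: x\<^sub>0_def y\<^sub>0_def)
  \<comment> \<open>One inequality comes from \<alpha> contracting the pair
    \<open>x\<^sub>0\<close>, \<open>y\<^sub>0\<close>, the other from \<beta> contracting the pair
    of their values.\<close>
  have iso: "\<bar>int x\<^sub>0 - int y\<^sub>0\<bar> = \<bar>int (\<alpha> 1) - int (\<alpha> n)\<bar>"
    using contr(1)[OF x\<^sub>0(1) y\<^sub>0(1)] contr(2)[OF \<alpha>_in[OF ends(1)] \<alpha>_in[OF ends(2)]] x\<^sub>0(2) y\<^sub>0(2)
    by (simp add: x\<^sub>0_def y\<^sub>0_def)
  have \<alpha>1: "\<alpha> 1 \<in> {1..n}" "\<alpha> n \<in> {1..n}" using \<alpha>_in ends by auto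
  consider "mono_on {1..n} \<alpha>" | "antimono_on {1..n} \<alpha>"
    using \<alpha> by (auto simp: ORCT_def)
  then show thesis
  proof cases
    case 1
    then have mono: "\<alpha> x \<le> \<alpha> y" if "x \<in> {1..n}" "y \<in> {1..n}" "x \<le> y" for x y
      using that by (auto simp: monotone_on_def)
    have le: "\<alpha> 1 \<le> \<alpha> n" using mono ends assms(2) by blast
    \<comment> \<open>If \<open>y\<^sub>0 < x\<^sub>0\<close>, monotonicity would make the end
      values equal, and \<open>iso\<close> would then make the two points equal.\<close>
    have xy: "x\<^sub>0 \<le> y\<^sub>0"
      using mono[OF y\<^sub>0(1) x\<^sub>0(1)] x\<^sub>0(2) y\<^sub>0(2) iso le by linarith
    have yn: "\<alpha> n = \<alpha> 1 + (y\<^sub>0 - x\<^sub>0)" using iso xy le by linarith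
    have b: "clamp_bounds n (y\<^sub>0 - x\<^sub>0) x\<^sub>0 (\<alpha> 1)"
      using x\<^sub>0 y\<^sub>0 xy yn \<alpha>1 by (auto simp: clamp_bounds_def)
    have eq: "\<alpha> x = clamp (y\<^sub>0 - x\<^sub>0) x\<^sub>0 (\<alpha> 1) False x" if x: "x \<in> {1..n}" for x
    proof -
      have "\<alpha> 1 \<le> \<alpha> x" "\<alpha> x \<le> \<alpha> n" using mono x ends by auto
      consider "x \<le> x\<^sub>0" | "y\<^sub>0 \<le> x" | "x\<^sub>0 \<le> x" "x \<le> y\<^sub>0" by linarith
      then show ?thesis
      proof cases
        case 1
        then show ?thesis
          using \<open>\<alpha> 1 \<le> \<alpha> x\<close> \<open>\<alpha> x \<le> \<alpha> n\<close> mono[OF x x\<^sub>0(1)] x\<^sub>0(2) yn by (simp add: clamp_left)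
      next
        case 2
        then show ?thesis
          using \<open>\<alpha> 1 \<le> \<alpha> x\<close> \<open>\<alpha> x \<le> \<alpha> n\<close> mono[OF y\<^sub>0(1) x] y\<^sub>0(2) yn xy by (simp add: clamp_right)
      next
        case 3
        \<comment> \<open>The values at \<open>x\<^sub>0\<close> and \<open>y\<^sub>0\<close> are as
          far apart as the points, so the contraction bounds from the two ends leave a single value
          for \<open>\<alpha> x\<close>.\<close>
        then show ?thesis
          using contr(1)[OF x x\<^sub>0(1)] contr(1)[OF x y\<^sub>0(1)] x\<^sub>0(2) y\<^sub>0(2) yn xy
          by (simp add: clamp_middle)
      qed
    qed
    have "\<alpha> = clamp_map n (y\<^sub>0 - x\<^sub>0) x\<^sub>0 (\<alpha> 1) False"
    proof
      fix x
      show "\<alpha> x = clamp_map n (y\<^sub>0 - x\<^sub>0) x\<^sub>0 (\<alpha> 1) False x"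
        using eq[of x] \<alpha>_ext[of x] unfolding clamp_map_def restrict_def by argo
    qed
    then show thesis using that b by blast
  next
    case 2
    then have anti: "\<alpha> y \<le> \<alpha> x" if "x \<in> {1..n}" "y \<in> {1..n}" "x \<le> y" for x y
      using that by (auto simp: monotone_on_def)
    have le: "\<alpha> n \<le> \<alpha> 1" using anti ends assms(2) by blast
    have xy: "x\<^sub>0 \<le> y\<^sub>0"
      using anti[OF y\<^sub>0(1) x\<^sub>0(1)] x\<^sub>0(2) y\<^sub>0(2) iso le by linarith
    have yn: "\<alpha> 1 = \<alpha> n + (y\<^sub>0 - x\<^sub>0)" using iso xy le by linarith
    \<comment> \<open>The least value is now \<open>\<alpha> n\<close>, so it is the left end of the
      image.\<close>
    have b: "clamp_bounds n (y\<^sub>0 - x\<^sub>0) x\<^sub>0 (\<alpha> n)"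
      using x\<^sub>0 y\<^sub>0 xy yn \<alpha>1 by (auto simp: clamp_bounds_def)
    have eq: "\<alpha> x = clamp (y\<^sub>0 - x\<^sub>0) x\<^sub>0 (\<alpha> n) True x" if x: "x \<in> {1..n}" for x
    proof -
      have "\<alpha> x \<le> \<alpha> 1" "\<alpha> n \<le> \<alpha> x" using anti x ends by auto
      consider "x \<le> x\<^sub>0" | "y\<^sub>0 \<le> x" | "x\<^sub>0 \<le> x" "x \<le> y\<^sub>0" by linarith
      then show ?thesis
      proof cases
        case 1
        then show ?thesis
          using \<open>\<alpha> n \<le> \<alpha> x\<close> \<open>\<alpha> x \<le> \<alpha> 1\<close> anti[OF x x\<^sub>0(1)] x\<^sub>0(2) yn by (simp add: clamp_left)
      next
        case 2
        then show ?thesis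
          using \<open>\<alpha> n \<le> \<alpha> x\<close> \<open>\<alpha> x \<le> \<alpha> 1\<close> anti[OF y\<^sub>0(1) x] y\<^sub>0(2) yn xy by (simp add: clamp_right)
      next
        case 3
        then show ?thesis
          using contr(1)[OF x x\<^sub>0(1)] contr(1)[OF x y\<^sub>0(1)] x\<^sub>0(2) y\<^sub>0(2) yn xy
          by (simp add: clamp_middle)
      qed
    qed
    have "\<alpha> = clamp_map n (y\<^sub>0 - x\<^sub>0) x\<^sub>0 (\<alpha> n) True"
    proof
      fix x
      show "\<alpha> x = clamp_map n (y\<^sub>0 - x\<^sub>0) x\<^sub>0 (\<alpha> n) True x"
        using eq[of x] \<alpha>_ext[of x] unfolding clamp_map_def restrict_def by argo
    qed
    then show thesis using that b by blast
  qed
qed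

section \<open>Products\<close>

text \<open>If \<open>{c..c + k}\<close> lies to one side of \<open>{d'..d' + k'}\<close>, the
  composite is constant and \<open>k'' = 0\<close>. Otherwise the intervals meet in
  \<open>{lo..hi}\<close>, and the composite carries the preimage of \<open>{lo..hi}\<close> onto
  its image.\<close>

lemma clamp_comp:
  assumes "clamp_bounds n k d c" "clamp_bounds n k' d' c'"
  obtains k'' d'' c'' r'' where "clamp_bounds n k'' d'' c''"
    "clamp k' d' c' r' \<circ> clamp k d c r = clamp k'' d'' c'' r''"
proof -
  consider "c + k < d'" | "d' + k' < c" | "d' \<le> c + k" "c \<le> d' + k'" by linarith
  then show thesis
  proof cases
    case 1
    have "clamp k' d' c' r' \<circ> clamp k d c r = clamp 0 d (if r' then c' + k' else c') False"
      using 1 by (auto simp: clamp_def fun_eq_iff)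
    moreover have "clamp_bounds n 0 d (if r' then c' + k' else c')"
      using assms by (auto simp: clamp_bounds_def)
    ultimately show thesis using that by blast
  next
    case 2
    have "clamp k' d' c' r' \<circ> clamp k d c r = clamp 0 d (if r' then c' else c' + k') False"
      using 2 by (auto simp: clamp_def fun_eq_iff)
    moreover have "clamp_bounds n 0 d (if r' then c' else c' + k')"
      using assms by (auto simp: clamp_bounds_def)
    ultimately show thesis using that by blast
  next
    case 3
    define lo where "lo = max c d'"
    define hi where "hi = min (c + k) (d' + k')"
    \<comment> \<open>\<open>d''\<close> is the left end of the preimage of \<open>{lo..hi}\<close>
      under the first map, \<open>c''\<close> the left end of its image under the second; a
      reflection measures from \<open>hi\<close>.\<close>
    define d'' where "d'' = d + (if r then c + k - hi else lo - c)"
    define c'' where "c'' = c' + (if r' then d' + k' - hi else lo - d')"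
    have bounds: "c \<le> lo" "d' \<le> lo" "hi \<le> c + k" "hi \<le> d' + k'" "lo \<le> hi"
      "lo = c \<or> lo = d'" "hi = c + k \<or> hi = d' + k'"
      using 3 by (auto simp: lo_def hi_def max_def min_def)
    have "clamp k' d' c' r' \<circ> clamp k d c r = clamp (hi - lo) d'' c'' (r \<noteq> r')"
    proof
      fix x
      define w where "w = clamp k d c r x"
      define m where "m = min (hi - lo) (w - lo)"
      have m: "m \<le> hi - lo" by (simp add: m_def)
      have w: "c \<le> w" "w \<le> c + k" by (auto simp: w_def clamp_def)
      \<comment> \<open>Clamping \<open>w\<close> to \<open>{lo..hi}\<close> loses nothing: an end
        of that interval not shared with \<open>{d'..d' + k'}\<close> is an end of
        \<open>{c..c + k}\<close>, which contains \<open>w\<close>.\<close>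
      have "min k' (w - d') = (lo - d') + m"
        using w bounds unfolding m_def by linarith
      then have "clamp k' d' c' r' w = c'' + (if r' then (hi - lo) - m else m)"
        using bounds m unfolding clamp_def c''_def by (cases r') simp_all
      moreover have "min (hi - lo) (x - d'') = (if r then (hi - lo) - m else m)"
      proof (cases r)
        case True
        then show ?thesis
          using bounds unfolding m_def d''_def w_def clamp_def by simp linarith
      next
        case False
        then show ?thesis
          using bounds unfolding m_def d''_def w_def clamp_def by simp linarith
      qed
      ultimately show "(clamp k' d' c' r' \<circ> clamp k d c r) x = clamp (hi - lo) d'' c'' (r \<noteq> r') x"
        using m bounds(5) by (auto simp: w_def[symmetric] clamp_def[of "hi - lo"])
    qed
    moreover have "clamp_bounds n (hi - lo) d'' c''"
      using assms bounds by (auto simp: clamp_bounds_def d''_def c''_def)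
    ultimately show thesis using that by blast
  qed
qed

text \<open>Regular elements of a semigroup need not be closed under products; here closure comes
  from the explicit form of the factors and of their composite.\<close>

lemma RegORCT_closed:
  assumes "\<alpha> \<in> RegORCT n" "\<beta> \<in> RegORCT n" "1 \<le> n"
  shows "map_mult n \<alpha> \<beta> \<in> RegORCT n"
proof -
  obtain k d c r where 1: "clamp_bounds n k d c" "\<alpha> = clamp_map n k d c r"
    using RegORCT_is_clamp_map assms by metis
  obtain k' d' c' r' where 2: "clamp_bounds n k' d' c'" "\<beta> = clamp_map n k' d' c' r'"
    using RegORCT_is_clamp_map assms by metis
  obtain k'' d'' c'' r'' where "clamp_bounds n k'' d'' c''"
    "clamp k' d' c' r' \<circ> clamp k d c r = clamp k'' d'' c'' r''"
    using clamp_comp[OF 1(1) 2(1)] by metis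
  then show ?thesis
    using map_mult_clamp_map[OF 1(1)] clamp_map_in_RegORCT 1(2) 2(2) by (simp add: clamp_map_def)
qed

text \<open>The right side feeds \<open>\<alpha> x\<close> to a product that is defined only on
  \<open>{1..n}\<close>, hence the condition on \<alpha>.\<close>

lemma map_mult_assoc:
  "\<alpha> \<in> {1..n} \<rightarrow> {1..n} \<Longrightarrow>
    map_mult n (map_mult n \<alpha> \<beta>) \<gamma> = map_mult n \<alpha> (map_mult n \<beta> \<gamma>)"
  by (auto simp: map_mult_def compose_def fun_eq_iff Pi_iff)

lemma RegORCT_Pi: "\<alpha> \<in> RegORCT n \<Longrightarrow> \<alpha> \<in> {1..n} \<rightarrow> {1..n}"
  by (auto simp: RegORCT_def regular_elements_def ORCT_def PiE_def)

lemma image_map_mult: "map_mult n \<alpha> \<beta> ` {1..n} = \<beta> ` \<alpha> ` {1..n}"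
  by (auto simp: map_mult_def compose_def image_iff)

lemma map_mult_in_K:
  assumes "\<alpha> \<in> RegORCT n" "\<beta> \<in> RegORCT n" "\<alpha> \<in> K n q \<or> \<beta> \<in> K n q" "1 \<le> n"
  shows "map_mult n \<alpha> \<beta> \<in> K n q"
proof -
  have "\<beta> ` \<alpha> ` {1..n} \<subseteq> \<beta> ` {1..n}"
    using RegORCT_Pi[OF assms(1)] by auto
  then have "card (\<beta> ` \<alpha> ` {1..n}) \<le> card (\<beta> ` {1..n})"
    by (intro card_mono) auto
  moreover have "card (\<beta> ` \<alpha> ` {1..n}) \<le> card (\<alpha> ` {1..n})"
    by (intro card_image_le) auto
  ultimately show ?thesis
    using assms RegORCT_closed by (auto simp: K_def image_map_mult)
qed

lemma semigroup_on_K: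
  assumes "1 \<le> n"
  shows "semigroup_on (K n q) (map_mult n)"
proof
  fix a b c assume "a \<in> K n q" "b \<in> K n q"
  then show "map_mult n a b \<in> K n q"
    using map_mult_in_K assms by (auto simp: K_def)
next
  fix a b c assume "a \<in> K n q"
  then show "map_mult n (map_mult n a b) c = map_mult n a (map_mult n b c)"
    by (intro map_mult_assoc RegORCT_Pi) (simp add: K_def)
qed

section \<open>The principal factor\<close>

text \<open>Two distinct intervals of equal length: \<open>{c..c + k}\<close> protrudes beyond
  \<open>{d'..d' + k}\<close> at one end, where the second factor identifies two neighbouring points
  of it. This lowers the rank.\<close>

lemma map_mult_mismatching_in_K:
  assumes "clamp_bounds n k d c" "clamp_bounds n k d' c'" "c \<noteq> d'" "1 \<le> k"
  shows "map_mult n (clamp_map n k d c r) (clamp_map n k d' c' r') \<in> K n k"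
proof -
  let ?f = "clamp k d' c' r'"
  have n: "1 \<le> n" using assms by (auto simp: clamp_bounds_def)
  have "\<not> inj_on ?f {c..c + k}"
  proof (cases "c < d'")
    case True
    then have "?f c = ?f (Suc c)" by (simp add: clamp_left)
    moreover have "c \<in> {c..c + k}" "Suc c \<in> {c..c + k}" using assms(4) by auto
    ultimately show ?thesis by (metis inj_onD n_not_Suc_n)
  next
    case False
    then have "?f (c + k) = ?f (c + k - 1)" using assms(3,4) by (subst (1 2) clamp_right) auto
    moreover have "c + k \<in> {c..c + k}" "c + k - 1 \<in> {c..c + k}" "c + k \<noteq> c + k - 1"
      using assms(4) by auto
    ultimately show ?thesis by (metis inj_onD)
  qed
  then have "card (?f ` {c..c + k}) < Suc k"
    using card_image_le[of "{c..c + k}" ?f] inj_on_iff_eq_card[of "{c..c + k}" ?f] by auto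
  moreover have "map_mult n (clamp_map n k d c r) (clamp_map n k d' c' r') ` {1..n} = ?f ` {c..c + k}"
    unfolding map_mult_clamp_map[OF assms(1)] using clamp_image[OF assms(1)]
    by (simp add: image_comp[symmetric] del: comp_apply)
  ultimately show ?thesis
    using RegORCT_closed clamp_map_in_RegORCT assms(1,2) n by (simp add: K_def)
qed

lemma clamp_map_notin_K: "clamp_bounds n k d c \<Longrightarrow> clamp_map n k d c r \<notin> K n k"
  by (simp add: K_def card_clamp_map)

text \<open>The value at \<open>d\<close> is \<open>c\<close> or \<open>c + k\<close> according to
  the orientation, and these differ because \<open>1 \<le> k\<close>; for constant maps the
  orientation would be ambiguous.\<close>

lemma clamp_map_orientation:
  assumes "clamp_bounds n k d c" "1 \<le> k" "clamp_map n k d c r = clamp_map n k d c r'"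
  shows "r = r'"
  using fun_cong[OF assms(3), of d] assms(1,2)
  by (auto simp: clamp_map_def clamp_def clamp_bounds_def split: if_splits)

text \<open>The matrix-unit rule of a Brandt semigroup, with exclusive or as the operation of the
  group of order two.\<close>

lemma Q_mult_clamp_map:
  assumes "clamp_bounds n k d c" "clamp_bounds n k d' c'" "1 \<le> k"
  shows "Q_mult n (Suc k) (Some (clamp_map n k d c r)) (Some (clamp_map n k d' c' r')) =
    (if c = d' then Some (clamp_map n k d c' (r \<noteq> r')) else None)"
proof (cases "c = d'")
  case True
  then have "clamp_bounds n k d c'" using assms by (auto simp: clamp_bounds_def)
  then show ?thesis
    using True map_mult_matching[OF assms(1)] clamp_map_notin_K by (simp add: Q_mult_def rees_mult_def)
next
  case False
  then show ?thesis
    using map_mult_mismatching_in_K[OF assms(1,2) False assms(3)] by (simp add: Q_mult_def rees_mult_def)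
qed

lemma Q_mult_None [simp]: "Q_mult n p None u = None" "Q_mult n p u None = None"
  by (auto simp: Q_mult_def rees_mult_def split: option.split)

lemma Q_carrier_eq:
  assumes "1 \<le> n"
  shows "Q_carrier n (Suc k) = insert None {Some (clamp_map n k d c r) |d c r. clamp_bounds n k d c}"
proof -
  have "K n (Suc k) - K n k = {clamp_map n k d c r |d c r. clamp_bounds n k d c}" (is "?L = ?R")
  proof
    show "?L \<subseteq> ?R"
    proof
      fix \<alpha> assume \<alpha>: "\<alpha> \<in> ?L"
      then obtain j d c r where j: "clamp_bounds n j d c" "\<alpha> = clamp_map n j d c r"
        using RegORCT_is_clamp_map assms unfolding K_def by blast
      with \<alpha> have "j = k" by (auto simp: K_def card_clamp_map)
      with j show "\<alpha> \<in> ?R" by blast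
    qed
    show "?R \<subseteq> ?L"
      by (auto simp: K_def clamp_map_in_RegORCT card_clamp_map)
  qed
  moreover have "Some ` ?R = {Some (clamp_map n k d c r) |d c r. clamp_bounds n k d c}" by auto
  ultimately show ?thesis by (simp only: Q_carrier_def rees_carrier_def diff_Suc_1)
qed

theorem theorem4p1:
  fixes n p :: nat
  assumes "2 \<le> p" and "p \<le> n"
  shows "inverse_semigroup_on (Q_carrier n p) (Q_mult n p)"
proof -
  obtain k where p: "p = Suc k" and k: "1 \<le> k"
    using assms(1) by (cases p) auto
  have n: "1 \<le> n" using assms by simp
  interpret semigroup_on "Q_carrier n p" "Q_mult n p"
    unfolding Q_carrier_def Q_mult_def
    by (rule semigroup_on_rees[OF semigroup_on_K[OF n]])
      (use map_mult_in_K n in \<open>auto simp: K_def\<close>)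
  show ?thesis
  proof
    fix a assume a: "a \<in> Q_carrier n p"
    let ?inverse = "\<lambda>b. b \<in> Q_carrier n p \<and>
      Q_mult n p (Q_mult n p a b) a = a \<and> Q_mult n p (Q_mult n p b a) b = b"
    show "\<exists>!b. ?inverse b"
    proof (cases a)
      case None
      \<comment> \<open>For \<open>a\<close> zero, \<open>bab = b\<close> forces \<open>b\<close> to
        be zero.\<close>
      then show ?thesis by (intro ex1I[of _ None]) (use a in auto)
    next
      case (Some \<alpha>)
      then obtain d c r where v: "clamp_bounds n k d c" and \<alpha>: "a = Some (clamp_map n k d c r)"
        using a Q_carrier_eq[OF n] p by auto
      have v': "clamp_bounds n k c d" "clamp_bounds n k d d" "clamp_bounds n k c c"
        using v by (auto simp: clamp_bounds_def)
      show ?thesis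
      proof (rule ex1I)
        show "?inverse (Some (clamp_map n k c d r))"
          using v v' k Q_carrier_eq[OF n] by (auto simp: \<alpha> p Q_mult_clamp_map)
      next
        fix b assume b: "?inverse b"
        then have "b \<noteq> None" unfolding \<alpha> by (metis Q_mult_None option.distinct(1))
        with b obtain d' c' r' where w: "clamp_bounds n k d' c'" and \<beta>: "b = Some (clamp_map n k d' c' r')"
          using Q_carrier_eq[OF n] p by auto
        \<comment> \<open>If \<open>ab\<close> or \<open>ba\<close> were zero, then
          \<open>aba = a\<close> or \<open>bab = b\<close> would make \<open>a\<close> or
          \<open>b\<close> zero. Nonzero products force the intervals to match.\<close>
        have "Q_mult n p a b \<noteq> None" "Q_mult n p b a \<noteq> None"
          using b unfolding \<alpha> \<beta> by (metis Q_mult_None(1) option.distinct(1))+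
        then have eq: "d' = c" "c' = d"
          using v w k by (auto simp: \<alpha> \<beta> p Q_mult_clamp_map split: if_splits)
        \<comment> \<open>This is \<open>aba = a\<close>; its orientation
          \<open>(r \<noteq> r') \<noteq> r\<close> equals \<open>r'\<close>, so comparing
          orientations gives \<open>r' = r\<close>.\<close>
        have "clamp_map n k d c ((r \<noteq> r') \<noteq> r) = clamp_map n k d c r"
          using b v v' k unfolding \<alpha> \<beta> p eq by (simp add: Q_mult_clamp_map)
        then have "r' = r" using clamp_map_orientation[OF v k] by blast
        then show "b = Some (clamp_map n k c d r)" by (simp add: \<beta> eq)
      qed
    qed
  qed
qed

end
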